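(* Let $r>2$ and $m\geq2$ be integers and let $C_{(r-1)m}$ be the $r$-uniform loose cycle with $m$ edges. Then $\mathrm{pmd}(C_{(r-1)m})=2$ if $m$ is even, and $\mathrm{pmd}(C_{(r-1)m})=3$ if $m$ is odd.
   Context: With $n=(r-1)m$, the $r$-uniform loose cycle $C_{(r-1)m}$ is the hypergraph on vertex set $[n]=\{1,\dots,n\}$ with the $m$ edges $\{1,\dots,r\},\ \{r,\dots,2r-1\},\ \ldots,\ \{n-r+2,\dots,n,1\}$. A matching is a set of pairwise disjoint edges. A positive matching of a hypergraph $(V,E)$ is a matching $M\subseteq E$ for which there is $w:V\to\mathbb{Q}$ with $\sum_{i\in e}w(i)>0$ for $e\in M$ and $\sum_{i\in e}w(i)<0$ for $e\in E\setminus M$. A positive matching decomposition of $H=(V,E)$ is a partition $E=\bigcup_{i=1}^pM_i$ into pairwise disjoint subsets such that $M_i$ is a positive matching on $(V,E\setminus\bigcup_{j=1}^{i-1}M_j)$ for $i=1,\dots,p$. The smallest such $p$ is denoted $\mathrm{pmd}(H)$. *)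

theory Defs
  imports Complex_Main "HOL-Library.FuncSet" "HOL-Library.Disjoint_Sets"
begin

text \<open>
  A hypergraph is given by its vertex set \<open>V\<close> and edge set \<open>E\<close>; the notions below are meant
  for finite \<open>V\<close> and \<open>E \<subseteq> Pow V\<close>.
\<close>

definition matching :: "'a set set \<Rightarrow> 'a set set \<Rightarrow> bool" where
  "matching E M \<longleftrightarrow> M \<subseteq> E \<and> disjoint M"

definition positive_matching :: "'a set \<Rightarrow> 'a set set \<Rightarrow> 'a set set \<Rightarrow> bool" where
  "positive_matching V E M \<longleftrightarrow>
     matching E M \<and>
     (\<exists>w \<in> V \<rightarrow>\<^sub>E (UNIV :: rat set).
        (\<forall>e\<in>M. (\<Sum>i\<in>e. w i) > 0) \<and> (\<forall>e\<in>E - M. (\<Sum>i\<in>e. w i) < 0))"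

text \<open>
  The parts \<open>M i\<close> may be empty. This does not affect \<open>pmd\<close>, since dropping the empty
  parts leaves a shorter decomposition.
\<close>

definition pos_matching_decomp ::
  "'a set \<Rightarrow> 'a set set \<Rightarrow> nat \<Rightarrow> (nat \<Rightarrow> 'a set set) \<Rightarrow> bool" where
  "pos_matching_decomp V E p M \<longleftrightarrow>
     E = (\<Union>i\<in>{1..p}. M i) \<and>
     disjoint_family_on M {1..p} \<and>
     (\<forall>i\<in>{1..p}. positive_matching V (E - (\<Union>j\<in>{1..<i}. M j)) (M i))"

definition pmd :: "'a set \<Rightarrow> 'a set set \<Rightarrow> nat" where
  "pmd V E = (LEAST p. \<exists>M. pos_matching_decomp V E p M)"

definition loose_cycle_vertices :: "nat \<Rightarrow> nat \<Rightarrow> nat set" where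
  "loose_cycle_vertices r m = {1..(r - 1) * m}"

text \<open>
  The first \<open>m - 1\<close> edges are intervals of length \<open>r\<close>; the last one closes the cycle at
  vertex \<open>1\<close>. The truncated subtractions are genuine for \<open>r \<ge> 2\<close> and \<open>m \<ge> 2\<close>.
\<close>

definition loose_cycle_edges :: "nat \<Rightarrow> nat \<Rightarrow> nat set set" where
  "loose_cycle_edges r m =
     (let n = (r - 1) * m in
        (\<lambda>k. {k * (r - 1) + 1..k * (r - 1) + r}) ` {..<m - 1} \<union> {insert 1 {n - r + 2..n}})"

lemma loose_cycle_edge_uniform:
  assumes "r > 2" "m \<ge> 2" "e \<in> loose_cycle_edges r m"
  shows "e \<subseteq> loose_cycle_vertices r m" "card e = r"
proof -
  define n where "n = (r - 1) * m"
  have n: "n \<ge> 2 * (r - 1)" unfolding n_def using assms by (simp add: mult.commute)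
  have "e \<subseteq> {1..n} \<and> card e = r"
  proof (cases "e = insert 1 {n - r + 2..n}")
    case True
    have "1 \<notin> {n - r + 2..n}" by auto
    then show ?thesis using True n assms(1) by auto
  next
    case False
    then obtain k where k: "k < m - 1" "e = {k * (r - 1) + 1..k * (r - 1) + r}"
      using assms(3) by (auto simp: loose_cycle_edges_def Let_def n_def)
    have "(k + 2) * (r - 1) \<le> m * (r - 1)" using k by (intro mult_right_mono) auto
    then have "k * (r - 1) + r \<le> n" using assms(1)
      by (simp add: n_def add_mult_distrib mult.commute)
    then show ?thesis using k by auto
  qed
  then show "e \<subseteq> loose_cycle_vertices r m" "card e = r"
    by (auto simp: loose_cycle_vertices_def n_def)
qed

lemma card_loose_cycle_edges:
  assumes "r > 2" "m \<ge> 2"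
  shows "card (loose_cycle_edges r m) = m"
proof -
  define n where "n = (r - 1) * m"
  define f where "f = (\<lambda>k. {k * (r - 1) + 1..k * (r - 1) + r})"
  have inj: "inj_on f {..<m - 1}"
    using assms by (auto simp: inj_on_def f_def Icc_eq_Icc)
  have n: "n \<ge> 2 * (r - 1)" unfolding n_def using assms by (simp add: mult.commute)
  have "insert 1 {n - r + 2..n} \<noteq> f k" for k
  proof
    assume *: "insert 1 {n - r + 2..n} = f k"
    then have "1 \<in> f k" by blast
    then have "k * (r - 1) = 0" by (simp add: f_def)
    then have "2 \<in> f k" using assms by (auto simp: f_def)
    then show False using n assms * by (auto simp flip: *)
  qed
  then have "insert 1 {n - r + 2..n} \<notin> f ` {..<m - 1}" by blast
  then show ?thesis
    using assms inj by (simp add: loose_cycle_edges_def Let_def f_def n_def card_image)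
qed

end

theory Submission
  imports Defs
begin

text \<open>
  Since \<open>r > 2\<close>, every edge of the loose cycle has an inner vertex that lies on no other edge.
  Such private vertices make positivity automatic: given a matching, put weight \<open>1\<close> on the
  private vertices of its edges, \<open>-1\<close> on the private vertices of the remaining edges, and \<open>0\<close>
  elsewhere. Then every edge weighs \<open>1\<close> or \<open>-1\<close>, as desired. So a positive matching
  decomposition is the same thing as a proper edge colouring
  (\<open>pos_matching_decomp_iff_proper_edge_colouring\<close>), and \<open>pmd\<close> is the chromatic index.

  Two distinct edges of the loose cycle meet exactly when they are cyclically consecutive
  (\<open>cycle_edges_meet_iff\<close>). Hence proper edge colourings of the loose cycle are proper colourings
  of the cyclic sequence \<open>0, \<dots>, m - 1\<close>, which needs two colours for even \<open>m\<close> and three for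
  odd \<open>m\<close> (\<open>cyclic_colouring_iff\<close>).
\<close>

section \<open>Positive matchings in the presence of private vertices\<close>

definition private_vertices :: "'a set \<Rightarrow> 'a set set \<Rightarrow> bool" where
  "private_vertices V E \<longleftrightarrow>
     (\<forall>e\<in>E. finite e \<and> e \<subseteq> V \<and> (\<exists>v\<in>e. \<forall>f\<in>E. v \<in> f \<longrightarrow> f = e))"

text \<open>
  With weights \<open>1\<close> and \<open>-1\<close> on the private vertices and \<open>0\<close> elsewhere, the sum over an edge has
  a single nonzero term, at its private vertex.
\<close>

lemma matching_imp_positive_matching:
  assumes "private_vertices V E" "matching E M"
  shows "positive_matching V E M"
proof -
  have "\<forall>e\<in>E. \<exists>v. v \<in> e \<and> (\<forall>f\<in>E. v \<in> f \<longrightarrow> f = e)"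
    using assms(1) unfolding private_vertices_def by blast
  then obtain pv where "\<forall>e\<in>E. pv e \<in> e \<and> (\<forall>f\<in>E. pv e \<in> f \<longrightarrow> f = e)"
    unfolding bchoice_iff by blast
  then have pv: "pv e \<in> e" "\<And>f. f \<in> E \<Longrightarrow> pv e \<in> f \<Longrightarrow> f = e" if "e \<in> E" for e
    using that by blast+
  define u :: "'a \<Rightarrow> rat"
    where "u x = (if x \<in> pv ` M then 1 else if x \<in> pv ` (E - M) then -1 else 0)" for x
  define w where "w = restrict u V"
  have ME: "M \<subseteq> E" using assms(2) by (simp add: matching_def)
  have sum_w: "(\<Sum>i\<in>e. w i) = u (pv e)" if e: "e \<in> E" for e
  proof -
    have fin: "finite e" and sub: "e \<subseteq> V"
      using assms(1) e by (auto simp: private_vertices_def)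
    have "u i = 0" if "i \<in> e - {pv e}" for i
      using that pv(2)[OF _ e] e ME by (auto simp: u_def)
    then have "(\<Sum>i\<in>e. u i) = (\<Sum>i\<in>{pv e}. u i)"
      using fin pv(1)[OF e] by (intro sum.mono_neutral_right) auto
    moreover have "(\<Sum>i\<in>e. w i) = (\<Sum>i\<in>e. u i)"
      using sub by (intro sum.cong) (auto simp: w_def)
    ultimately show ?thesis by simp
  qed
  have "u (pv e) = -1" if e: "e \<in> E - M" for e
  proof -
    have "pv e \<notin> pv ` M"
    proof
      assume "pv e \<in> pv ` M"
      then obtain f where f: "f \<in> M" "pv e = pv f" by auto
      then have "e = f" using pv(1)[of e] pv(2)[of f e] e ME by auto
      then show False using f e by simp
    qed
    then show ?thesis using e by (simp add: u_def)
  qed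
  then have "\<forall>e\<in>E - M. (\<Sum>i\<in>e. w i) < 0" by (simp add: sum_w)
  moreover have "\<forall>e\<in>M. (\<Sum>i\<in>e. w i) > 0" using ME by (auto simp: sum_w u_def)
  moreover have "w \<in> V \<rightarrow>\<^sub>E UNIV" by (simp add: w_def)
  ultimately show ?thesis using assms(2) unfolding positive_matching_def by blast
qed

text \<open>
  The colour classes of a proper edge colouring are the parts of a decomposition. Deleting edges
  keeps vertices private, so each class is positive in the hypergraph left over at its turn.
\<close>

lemma pos_matching_decomp_iff_proper_edge_colouring:
  assumes "private_vertices V E"
  shows "(\<exists>M. pos_matching_decomp V E p M) \<longleftrightarrow>
    (\<exists>c. (\<forall>e\<in>E. c e \<in> {1..p}) \<and>
         (\<forall>e\<in>E. \<forall>f\<in>E. e \<noteq> f \<longrightarrow> c e = c f \<longrightarrow> e \<inter> f = {}))"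
    (is "?L \<longleftrightarrow> ?R")
proof
  assume ?L
  then obtain M where M: "pos_matching_decomp V E p M" ..
  have E: "E = (\<Union>i\<in>{1..p}. M i)"
    using M unfolding pos_matching_decomp_def by (elim conjE)
  have disj: "disjoint (M i)" if "i \<in> {1..p}" for i
    using M that unfolding pos_matching_decomp_def positive_matching_def matching_def by simp
  have "\<forall>e\<in>E. \<exists>i. i \<in> {1..p} \<and> e \<in> M i"
  proof
    fix e assume "e \<in> E"
    then show "\<exists>i. i \<in> {1..p} \<and> e \<in> M i" unfolding E by (simp add: Bex_def)
  qed
  from bchoice[OF this] obtain c where c: "\<forall>e\<in>E. c e \<in> {1..p} \<and> e \<in> M (c e)" ..
  have "e \<inter> f = {}" if "e \<in> E" "f \<in> E" "e \<noteq> f" "c e = c f" for e f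
  proof (rule disjointD[OF disj])
    show "c e \<in> {1..p}" "e \<in> M (c e)" using c that(1) by simp_all
    show "f \<in> M (c e)" using c that(2) by (simp add: that(4))
  qed (rule that(3))
  then show ?R using c by (intro exI[of _ c]) simp
next
  assume ?R
  then obtain c where c: "\<forall>e\<in>E. c e \<in> {1..p}"
    and proper: "\<forall>e\<in>E. \<forall>f\<in>E. e \<noteq> f \<longrightarrow> c e = c f \<longrightarrow> e \<inter> f = {}"
    by (elim exE conjE)
  define M where "M i = {e\<in>E. c e = i}" for i
  have "positive_matching V (E - (\<Union>j\<in>{1..<i}. M j)) (M i)" for i
  proof (rule matching_imp_positive_matching)
    show "private_vertices V (E - (\<Union>j\<in>{1..<i}. M j))"
      using assms unfolding private_vertices_def by (meson DiffD1)
    have "disjoint (M i)" using proper by (simp add: M_def disjoint_def)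
    then show "matching (E - (\<Union>j\<in>{1..<i}. M j)) (M i)"
      by (auto simp: matching_def M_def)
  qed
  moreover have "E = (\<Union>i\<in>{1..p}. M i)" using c by (auto simp: M_def)
  moreover have "disjoint_family_on M {1..p}" by (auto simp: disjoint_family_on_def M_def)
  ultimately show ?L unfolding pos_matching_decomp_def by (intro exI[of _ M]) simp
qed

section \<open>Incidences in the loose cycle\<close>

text \<open>
  The edges of the loose cycle, indexed by \<open>k < m\<close>, with \<open>d = r - 1\<close>. After shifting vertices down
  by one, edge \<open>k\<close> is the block of numbers with quotient \<open>k\<close> by \<open>d\<close>, together with the first
  element of the cyclically next block. This describes the closing edge and the others alike.
\<close>

definition cycle_edge :: "nat \<Rightarrow> nat \<Rightarrow> nat \<Rightarrow> nat set" where
  "cycle_edge d m k = Suc ` {y. y div d = k \<or> y = (Suc k mod m) * d}"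

lemma cycle_edge_eq:
  assumes "d > 0"
  shows "cycle_edge d m k = insert (Suc ((Suc k mod m) * d)) {k * d + 1..k * d + d}"
proof -
  have "y div d = k \<longleftrightarrow> k * d \<le> y \<and> y < k * d + d" for y
  proof -
    have "y div d = k \<longleftrightarrow> k \<le> y div d \<and> y div d < Suc k" by auto
    also have "\<dots> \<longleftrightarrow> k * d \<le> y \<and> y < Suc k * d"
      using assms by (simp only: less_eq_div_iff_mult_less_eq div_less_iff_less_mult)
    finally show ?thesis by (simp add: add.commute)
  qed
  then have "{y. y div d = k \<or> y = (Suc k mod m) * d}
      = insert ((Suc k mod m) * d) {k * d..<k * d + d}"
    by (intro set_eqI) (simp only: mem_Collect_eq insert_iff atLeastLessThan_iff disj_commute)
  then show ?thesis
    by (simp add: cycle_edge_def image_Suc_atLeastLessThan atLeastLessThanSuc_atLeastAtMost)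
qed

lemma loose_cycle_edges_eq:
  assumes "r > 2" "m \<ge> 2"
  shows "loose_cycle_edges r m = cycle_edge (r - 1) m ` {..<m}"
proof -
  obtain d where r: "r = Suc d" and d: "d \<ge> 2" using assms(1) by (cases r) auto
  obtain l where m: "m = Suc l" and l: "l \<ge> 1" using assms(2) by (cases m) auto
  have inner: "cycle_edge d m k = {k * d + 1..k * d + r}" if "k < l" for k
    using that d by (auto simp: cycle_edge_eq m r)
  have "d * m - r + 2 = l * d + 1" using d l by (cases l) (auto simp: m r algebra_simps)
  moreover have "d * m = l * d + d" by (simp add: m mult.commute)
  ultimately have last: "cycle_edge d m l = insert 1 {d * m - r + 2..d * m}"
    using d by (simp add: cycle_edge_eq m mult.commute add.commute)
  have "loose_cycle_edges r m = (\<lambda>k. {k * d + 1..k * d + r}) ` {..<l} \<union> {cycle_edge d m l}"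
    unfolding last by (simp add: loose_cycle_edges_def Let_def r m)
  also have "\<dots> = cycle_edge d m ` {..<l} \<union> {cycle_edge d m l}"
    using inner by (simp cong: image_cong_simp)
  also have "\<dots> = cycle_edge d m ` {..<m}" by (auto simp: m lessThan_Suc)
  finally show ?thesis by (simp add: r)
qed

text \<open>
  The second vertex of edge \<open>k\<close> is private. For \<open>d = 1\<close> this fails: it is then the first vertex of
  the next edge.
\<close>

lemma private_vertex_iff:
  assumes "d \<ge> 2"
  shows "Suc (k * d + 1) \<in> cycle_edge d m j \<longleftrightarrow> j = k"
proof -
  have "(k * d + 1) div d = k" using assms by (intro div_nat_eqI) auto
  moreover have "k * d + 1 \<noteq> i * d" for i
  proof
    assume "k * d + 1 = i * d"
    then have "(k * d + 1) mod d = (i * d) mod d" by simp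
    then show False using assms by (simp add: mod_Suc)
  qed
  ultimately show ?thesis by (auto simp: cycle_edge_def)
qed

lemma inj_on_cycle_edge:
  assumes "d \<ge> 2"
  shows "inj_on (cycle_edge d m) A"
proof (rule inj_onI)
  fix j k assume "cycle_edge d m j = cycle_edge d m k"
  then have "Suc (k * d + 1) \<in> cycle_edge d m j"
    using private_vertex_iff[OF assms, of k m k] by simp
  then show "j = k" using private_vertex_iff[OF assms, of k m j] by simp
qed

lemma private_vertices_loose_cycle:
  assumes "r > 2" "m \<ge> 2"
  shows "private_vertices (loose_cycle_vertices r m) (loose_cycle_edges r m)"
  unfolding private_vertices_def
proof (intro ballI conjI)
  fix e assume e: "e \<in> loose_cycle_edges r m"
  show sub: "e \<subseteq> loose_cycle_vertices r m" using loose_cycle_edge_uniform(1)[OF assms e] .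
  show "finite e" using sub by (rule finite_subset) (simp add: loose_cycle_vertices_def)
  have d: "r - 1 \<ge> 2" using assms by simp
  obtain k where k: "e = cycle_edge (r - 1) m k"
    using e unfolding loose_cycle_edges_eq[OF assms] by blast
  show "\<exists>v\<in>e. \<forall>f\<in>loose_cycle_edges r m. v \<in> f \<longrightarrow> f = e"
  proof (intro bexI ballI impI)
    show "Suc (k * (r - 1) + 1) \<in> e" using private_vertex_iff[OF d, of k m k] k by simp
    fix f assume "f \<in> loose_cycle_edges r m" and v: "Suc (k * (r - 1) + 1) \<in> f"
    then obtain j where j: "f = cycle_edge (r - 1) m j"
      unfolding loose_cycle_edges_eq[OF assms] by blast
    show "f = e" using v private_vertex_iff[OF d, of k m j] unfolding j k by simp
  qed
qed

text \<open>
  The blocks are disjoint, and distinct edges are closed by distinct vertices. So a common vertex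
  closes one of the two edges and lies in the block of the other.
\<close>

lemma cycle_edges_meet_iff:
  assumes "d > 0" "j < m" "k < m" "j \<noteq> k"
  shows "cycle_edge d m j \<inter> cycle_edge d m k \<noteq> {} \<longleftrightarrow> k = Suc j mod m \<or> j = Suc k mod m"
proof
  assume "cycle_edge d m j \<inter> cycle_edge d m k \<noteq> {}"
  then obtain y where "y div d = j \<or> y = (Suc j mod m) * d" "y div d = k \<or> y = (Suc k mod m) * d"
    by (auto simp: cycle_edge_def)
  moreover have "Suc j mod m \<noteq> Suc k mod m" using assms by (auto simp: mod_Suc)
  ultimately show "k = Suc j mod m \<or> j = Suc k mod m" using assms by auto
next
  have "Suc ((Suc i mod m) * d) \<in> cycle_edge d m i \<inter> cycle_edge d m (Suc i mod m)" for i
    using assms(1) by (auto simp: cycle_edge_def)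
  then show "k = Suc j mod m \<or> j = Suc k mod m \<Longrightarrow>
      cycle_edge d m j \<inter> cycle_edge d m k \<noteq> {}"
    by blast
qed

section \<open>Colouring the cycle\<close>

text \<open>
  Colouring indices by parity works except at the wrap-around of an odd cycle, where the last
  index gets a colour of its own. Conversely, two colours must alternate along the cycle, so its
  length is even.
\<close>

lemma cyclic_colouring_iff:
  fixes m p :: nat
  assumes "m \<ge> 2"
  shows "(\<exists>c. (\<forall>k<m. c k \<in> {1..p}) \<and> (\<forall>k<m. c k \<noteq> c (Suc k mod m))) \<longleftrightarrow>
    (if even m then 2 else 3) \<le> p"
    (is "?L \<longleftrightarrow> ?R")
proof
  assume ?L
  then obtain c where c: "\<And>k. k < m \<Longrightarrow> c k \<in> {1..p}"
    and neq: "\<And>k. k < m \<Longrightarrow> c k \<noteq> c (Suc k mod m)" by blast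
  have neq_Suc: "c k \<noteq> c (Suc k)" if "Suc k < m" for k using neq[of k] that by simp
  have p2: "p \<ge> 2" using c[of 0] c[of 1] neq_Suc[of 0] assms by auto
  have "p \<noteq> 2" if "odd m"
  proof
    assume p: "p = 2"
    have alt: "c k = c 0 \<longleftrightarrow> even k" if "k < m" for k
      using that
    proof (induction k)
      case (Suc k)
      then show ?case using c[of 0] c[of k] c[of "Suc k"] neq_Suc[of k] p by auto
    qed simp
    have "c (m - 1) = c 0" using alt[of "m - 1"] assms that by simp
    then show False using neq[of "m - 1"] assms by simp
  qed
  then show ?R using p2 by auto
next
  assume R: ?R
  define c where "c k = (if odd m \<and> k = m - 1 then 3 else if even k then 1 else 2 :: nat)" for k
  have "c k \<in> {1..p}" for k using R by (auto simp: c_def split: if_splits)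
  moreover have "c k \<noteq> c (Suc k mod m)" if "k < m" for k
  proof (cases "Suc k = m")
    case True
    then show ?thesis using assms by (auto simp: c_def)
  next
    case False
    then show ?thesis using that by (auto simp: c_def)
  qed
  ultimately show ?L by blast
qed

lemma loose_cycle_decomp_iff_cyclic_colouring:
  assumes "r > 2" "m \<ge> 2"
  shows "(\<exists>M. pos_matching_decomp (loose_cycle_vertices r m) (loose_cycle_edges r m) p M) \<longleftrightarrow>
    (\<exists>c. (\<forall>k<m. c k \<in> {1..p}) \<and> (\<forall>k<m. c k \<noteq> c (Suc k mod m)))"
    (is "_ \<longleftrightarrow> ?R")
proof -
  define edge where "edge = cycle_edge (r - 1) m"
  have d: "r - 1 \<ge> 2" using assms by simp
  have inj: "inj_on edge {..<m}" unfolding edge_def using inj_on_cycle_edge[OF d] .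
  have meet: "edge j \<inter> edge k \<noteq> {} \<longleftrightarrow> k = Suc j mod m \<or> j = Suc k mod m"
    if "j < m" "k < m" "j \<noteq> k" for j k
    unfolding edge_def using that d by (intro cycle_edges_meet_iff) auto
  have succ: "Suc k mod m < m" "k \<noteq> Suc k mod m" if "k < m" for k
  proof -
    show "Suc k mod m < m" using that by simp
    show "k \<noteq> Suc k mod m" using that assms(2) by (cases "Suc k = m") auto
  qed
  have "(\<exists>c. (\<forall>e\<in>edge ` {..<m}. c e \<in> {1..p}) \<and>
      (\<forall>e\<in>edge ` {..<m}. \<forall>f\<in>edge ` {..<m}. e \<noteq> f \<longrightarrow> c e = c f \<longrightarrow> e \<inter> f = {})) \<longleftrightarrow> ?R"
    (is "?C \<longleftrightarrow> _")
  proof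
    assume ?C
    then obtain c where cE: "\<forall>e\<in>edge ` {..<m}. c e \<in> {1..p}"
      and properE: "\<forall>e\<in>edge ` {..<m}. \<forall>f\<in>edge ` {..<m}. e \<noteq> f \<longrightarrow> c e = c f \<longrightarrow> e \<inter> f = {}"
      by (elim exE conjE)
    have c: "c (edge k) \<in> {1..p}" if "k < m" for k using cE that by simp
    have proper: "edge j \<inter> edge k = {}"
      if "j < m" "k < m" "edge j \<noteq> edge k" "c (edge j) = c (edge k)" for j k
      using properE that by simp
    have "c (edge k) \<noteq> c (edge (Suc k mod m))" if "k < m" for k
    proof -
      have "edge k \<noteq> edge (Suc k mod m)"
        using inj_onD[OF inj, of k "Suc k mod m"] succ[OF that] that by blast
      then show ?thesis
        using proper[OF that succ(1)[OF that]] meet[OF that succ(1)[OF that] succ(2)[OF that]]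
        by blast
    qed
    then show ?R using c by (intro exI[of _ "c \<circ> edge"]) auto
  next
    assume ?R
    then obtain c where c: "\<And>k. k < m \<Longrightarrow> c k \<in> {1..p}"
      and neq: "\<And>k. k < m \<Longrightarrow> c k \<noteq> c (Suc k mod m)" by blast
    have inv: "inv_into {..<m} edge (edge k) = k" if "k < m" for k
      using inj that by (simp add: inv_into_f_f)
    have "edge j \<inter> edge k = {}" if "j < m" "k < m" "edge j \<noteq> edge k" "c j = c k" for j k
    proof -
      have "j \<noteq> k" "k \<noteq> Suc j mod m" "j \<noteq> Suc k mod m"
        using that neq[OF that(1)] neq[OF that(2)] by auto
      then show ?thesis using meet[OF that(1,2)] by simp
    qed
    then show ?C
      using c by (intro exI[of _ "c \<circ> inv_into {..<m} edge"]) (simp add: inv)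
  qed
  moreover have "loose_cycle_edges r m = edge ` {..<m}"
    by (simp only: edge_def loose_cycle_edges_eq[OF assms])
  ultimately show ?thesis
    using pos_matching_decomp_iff_proper_edge_colouring
      [OF private_vertices_loose_cycle[OF assms], of p]
    by simp
qed

theorem corollary3p3:
  fixes r m :: nat
  assumes "r > 2" and "m \<ge> 2"
  shows "(even m \<longrightarrow> pmd (loose_cycle_vertices r m) (loose_cycle_edges r m) = 2) \<and>
         (odd m \<longrightarrow> pmd (loose_cycle_vertices r m) (loose_cycle_edges r m) = 3)"
proof -
  have "pmd (loose_cycle_vertices r m) (loose_cycle_edges r m)
      = (LEAST p. (if even m then 2 else 3) \<le> p)"
    unfolding pmd_def loose_cycle_decomp_iff_cyclic_colouring[OF assms]
      cyclic_colouring_iff[OF assms(2)] ..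
  also have "\<dots> = (if even m then 2 else 3)" by (rule Least_equality) auto
  finally show ?thesis by simp
qed

end
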